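(* Suppose that the lower level feasible set mapping $x\mapsto U\cap K(x)$ is fixed on $X\cap\operatorname{dom}(U\cap K)$, i.e. $U\cap K(x)=U\cap K(x')$ for all $x,x'\in X\cap\operatorname{dom}(U\cap K)$. If $(x^*,y^*,w^* )$ is an equilibrium of the generalized Nash equilibrium problem (GNEP), then $(x^*,y^* )$ is a global solution of the standard optimistic bilevel problem (SBP).
   Context: Data and standing assumptions: $F,f:\mathbb{R}^{n_1}\times\mathbb{R}^{n_2}\to\mathbb{R}$ and $g:\mathbb{R}^{n_1}\times\mathbb{R}^{n_2}\to\mathbb{R}^m$ are continuous; $X\subseteq\mathbb{R}^{n_1}$ and $U\subseteq\mathbb{R}^{n_2}$ are closed. Vector inequalities are componentwise. Let $K(x):=\{v\in\mathbb{R}^{n_2}: g(x,v)\le 0\}$, $\operatorname{dom}(U\cap K):=\{x\in\mathbb{R}^{n_1}: U\cap K(x)\ne\emptyset\}$, and let $S(x)$ be the set of global minimizers of $w\mapsto f(x,w)$ over $w\in U\cap K(x)$ (empty if there are none). SBP: minimize $F(x,y)$ over $(x,y)\in W$, where $W:=\{(x,y): x\in X,\ y\in S(x)\}$. A global solution of the SBP is a point $(x^*,y^* )\in W$ with $F(x^*,y^* )\le F(x,y)$ for all $(x,y)\in W$. GNEP: a two-player game in which the leader controls $(x,y)$ and minimizes $F(x,y)$ subject to $(x,y)\in X\times U$, $f(x,y)\le f(x,w)$, $g(x,y)\le 0$, while the follower controls $w$ and minimizes $f(x,w)$ subject to $w\in U$, $g(x,w)\le 0$. For $w\in\mathbb{R}^{n_2}$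 put $V(w):=\{(u,v)\in X\times U: f(u,v)\le f(u,w),\ g(u,v)\le 0\}$. An equilibrium (solution) of the GNEP is a triple $(x^*,y^*,w^* )$ such that $(x^*,y^* )\in V(w^* )$; $F(x^*,y^* )\le F(x,y)$ for all $(x,y)\in V(w^* )$; $w^*\in U\cap K(x^* )$; and $f(x^*,w^* )\le f(x^*,w)$ for all $w\in U\cap K(x^* )$. *)

theory Defs
  imports "HOL-Analysis.Analysis"
begin

text \<open>
  A pair \<open>(x, y)\<close> of upper and lower level variables has type \<open>real^'n1 \<times> real^'n2\<close>.
  The library order on \<open>real^'m\<close> is the componentwise one (\<open>less_eq_vec_def\<close>), so that
  \<open>g (x, v) \<le> 0\<close> is a system of \<open>CARD('m)\<close> scalar inequalities.
\<close>

definition constraint_set ::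
    "((real^'n1) \<times> (real^'n2) \<Rightarrow> real^'m) \<Rightarrow> real^'n1 \<Rightarrow> (real^'n2) set"
  where "constraint_set g x = {v. g (x, v) \<le> 0}"

definition lower_feasible ::
    "((real^'n1) \<times> (real^'n2) \<Rightarrow> real^'m) \<Rightarrow> (real^'n2) set \<Rightarrow> real^'n1 \<Rightarrow> (real^'n2) set"
  where "lower_feasible g U x = U \<inter> constraint_set g x"

definition lower_dom ::
    "((real^'n1) \<times> (real^'n2) \<Rightarrow> real^'m) \<Rightarrow> (real^'n2) set \<Rightarrow> (real^'n1) set"
  where "lower_dom g U = {x. lower_feasible g U x \<noteq> {}}"

definition lower_solutions ::
    "((real^'n1) \<times> (real^'n2) \<Rightarrow> real) \<Rightarrow> ((real^'n1) \<times> (real^'n2) \<Rightarrow> real^'m)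
      \<Rightarrow> (real^'n2) set \<Rightarrow> real^'n1 \<Rightarrow> (real^'n2) set"
  where "lower_solutions f g U x =
    {y \<in> lower_feasible g U x. \<forall>w \<in> lower_feasible g U x. f (x, y) \<le> f (x, w)}"

definition sbp_feasible ::
    "((real^'n1) \<times> (real^'n2) \<Rightarrow> real) \<Rightarrow> ((real^'n1) \<times> (real^'n2) \<Rightarrow> real^'m)
      \<Rightarrow> (real^'n1) set \<Rightarrow> (real^'n2) set \<Rightarrow> ((real^'n1) \<times> (real^'n2)) set"
  where "sbp_feasible f g X U = {(x, y). x \<in> X \<and> y \<in> lower_solutions f g U x}"

definition sbp_global_solution ::
    "((real^'n1) \<times> (real^'n2) \<Rightarrow> real) \<Rightarrow> ((real^'n1) \<times> (real^'n2) \<Rightarrow> real)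
      \<Rightarrow> ((real^'n1) \<times> (real^'n2) \<Rightarrow> real^'m)
      \<Rightarrow> (real^'n1) set \<Rightarrow> (real^'n2) set \<Rightarrow> (real^'n1) \<times> (real^'n2) \<Rightarrow> bool"
  where "sbp_global_solution F f g X U p \<longleftrightarrow>
    p \<in> sbp_feasible f g X U \<and> (\<forall>q \<in> sbp_feasible f g X U. F p \<le> F q)"

text \<open>The feasible set of the leader, which depends on the strategy \<open>w\<close> of the follower.\<close>

definition leader_feasible ::
    "((real^'n1) \<times> (real^'n2) \<Rightarrow> real) \<Rightarrow> ((real^'n1) \<times> (real^'n2) \<Rightarrow> real^'m)
      \<Rightarrow> (real^'n1) set \<Rightarrow> (real^'n2) set \<Rightarrow> real^'n2 \<Rightarrow> ((real^'n1) \<times> (real^'n2)) set"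
  where "leader_feasible f g X U w =
    {(u, v). u \<in> X \<and> v \<in> U \<and> f (u, v) \<le> f (u, w) \<and> g (u, v) \<le> 0}"

definition gnep_equilibrium ::
    "((real^'n1) \<times> (real^'n2) \<Rightarrow> real) \<Rightarrow> ((real^'n1) \<times> (real^'n2) \<Rightarrow> real)
      \<Rightarrow> ((real^'n1) \<times> (real^'n2) \<Rightarrow> real^'m)
      \<Rightarrow> (real^'n1) set \<Rightarrow> (real^'n2) set \<Rightarrow> real^'n1 \<Rightarrow> real^'n2 \<Rightarrow> real^'n2 \<Rightarrow> bool"
  where "gnep_equilibrium F f g X U x y w \<longleftrightarrow>
    (x, y) \<in> leader_feasible f g X U w \<and>
    (\<forall>q \<in> leader_feasible f g X U w. F (x, y) \<le> F q) \<and>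
    w \<in> lower_feasible g U x \<and>
    (\<forall>w' \<in> lower_feasible g U x. f (x, w) \<le> f (x, w'))"

end

theory Submission
  imports Defs
begin

text \<open>
  At an equilibrium the follower's strategy \<open>w\<close> is optimal, so the leader's constraint
  \<open>f (x, y) \<le> f (x, w)\<close> makes \<open>y\<close> optimal as well. Conversely, as the lower level feasible set is
  fixed, \<open>w\<close> stays feasible for every \<open>x\<close>, so every bilevel feasible point satisfies
  \<open>f (x, y) \<le> f (x, w)\<close> and is available to the leader.
\<close>

lemma leader_feasible_iff:
  "(x, y) \<in> leader_feasible f g X U w \<longleftrightarrow>
    x \<in> X \<and> y \<in> lower_feasible g U x \<and> f (x, y) \<le> f (x, w)"
  by (auto simp: leader_feasible_def lower_feasible_def constraint_set_def)

lemma gnep_equilibrium_sbp_feasible: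
  assumes "gnep_equilibrium F f g X U x y w"
  shows "(x, y) \<in> sbp_feasible f g X U"
  using assms
  by (fastforce simp: gnep_equilibrium_def leader_feasible_iff sbp_feasible_def lower_solutions_def)

text \<open>For a bilevel feasible \<open>(x, y)\<close>, \<open>y\<close> itself witnesses that
  \<open>x\<close> lies in \<open>lower_dom g U\<close>. Hence \<open>w\<close> competes with
  \<open>y\<close> at \<open>x\<close>, and optimality of \<open>y\<close> yields the leader's
  constraint.\<close>

lemma sbp_feasible_subset_leader_feasible:
  assumes "\<And>x. x \<in> X \<inter> lower_dom g U \<Longrightarrow> w \<in> lower_feasible g U x"
  shows "sbp_feasible f g X U \<subseteq> leader_feasible f g X U w"
  using assms
  by (fastforce simp: sbp_feasible_def lower_solutions_def lower_dom_def leader_feasible_iff)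

theorem corollary3p6:
  fixes F f :: "(real^'n1) \<times> (real^'n2) \<Rightarrow> real"
    and g :: "(real^'n1) \<times> (real^'n2) \<Rightarrow> real^'m"
    and X :: "(real^'n1) set" and U :: "(real^'n2) set"
    and xs :: "real^'n1" and ys ws :: "real^'n2"
  assumes "continuous_on UNIV F" and "continuous_on UNIV f" and "continuous_on UNIV g"
    and "closed X" and "closed U"
    and "\<forall>x \<in> X \<inter> lower_dom g U. \<forall>x' \<in> X \<inter> lower_dom g U.
           lower_feasible g U x = lower_feasible g U x'"
    and "gnep_equilibrium F f g X U xs ys ws"
  shows "sbp_global_solution F f g X U (xs, ys)"
proof -
  have ws: "ws \<in> lower_feasible g U xs" and "xs \<in> X"
    and opt: "\<forall>q \<in> leader_feasible f g X U ws. F (xs, ys) \<le> F q"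
    using assms(7) by (auto simp: gnep_equilibrium_def leader_feasible_iff)
  \<comment> \<open>The point \<open>ws\<close> witnesses nonemptiness at \<open>xs\<close>, so
    fixedness can carry \<open>ws\<close> from \<open>xs\<close> to every other \<open>x\<close> in
    the domain.\<close>
  then have "xs \<in> X \<inter> lower_dom g U"
    by (auto simp: lower_dom_def)
  then have "ws \<in> lower_feasible g U x" if "x \<in> X \<inter> lower_dom g U" for x
    using assms(6) that ws by blast
  then have "sbp_feasible f g X U \<subseteq> leader_feasible f g X U ws"
    by (rule sbp_feasible_subset_leader_feasible)
  \<comment> \<open>A minimizer over the larger set that lies in the smaller one is a minimizer
    there.\<close>
  with opt gnep_equilibrium_sbp_feasible[OF assms(7)] show ?thesis
    by (auto simp: sbp_global_solution_def)
qed

end
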